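(* If $T$ is a strong mixing $G$-action with $G=\mathbb{R}^d$ or $G=\mathbb{Z}^d$, then $T$ is strong mixing in every direction $L\in\mathbb{G}_{e,d}$, $1\le e\le d$.
   Context: All actions are free measurable measure preserving actions on a Lebesgue probability space $(X,\mu)$. $\mathbb{G}_{e,d}$ is the set of $e$-dimensional linear subspaces of $\mathbb{R}^d$. For an action $T$ of a group $G$ (where $G$ is $\mathbb{R}^d$, $\mathbb{Z}^d$ or a closed subgroup of one of these), $(U_T^gf)(x)=f(T^gx)$ denotes the Koopman representation on $L^2(X,\mu)$, and $T$ is strong mixing if for each $f\in L^2(X,\mu)$ with $\int f\,d\mu=0$ one has $(U_T^gf,f)\to0$ as $g\to\infty$ in $G$. An $\mathbb{R}^d$-action $T$ is strong mixing in the direction $L$ if the $L$-action $\{T^{\vec t}\}_{\vec t\in L}$ is strong mixing. For a $\mathbb{Z}^d$-action $T$, let $\widetilde T$ be the unit suspension, i.e. the $\mathbb{R}^d$-action on $(\widetilde X,\tilde\mu)=(X\times[0,1)^d,\mu\times\lambda)$, $\lambda$ Lebesgue measure, given by $\widetilde T^{\vec t}(x,\vec r)=(T^{\lfloor\vec t+\vec r\rfloor}x,\{\vec t+\vec r\})$, with componentwise integer part $\lfloor\cdot\rfloor$ and fractional part $\{\cdot\}$. Let $\mathcal{O}=\{F(x,\vec s)=f(\vec s): f\in L^2([0,1)^d,\lambda)\}$ and $L^2_{\mathcal{O}}(\widetilde X,\tilde\mu)=\mathcal{O}^\perp\subseteq L^2(\widetilde X,\tilde\mu)$. $T$ is strong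 mixing in the direction $L$ if for every $f\in L^2_{\mathcal{O}}(\widetilde X,\tilde\mu)$ one has $(U_{\widetilde T}^{\vec t}f,f)\to0$ as $\|\vec t\|\to\infty$ with $\vec t\in L$. *)

theory Defs
  imports "HOL-Analysis.Analysis" "HOL-Probability.Probability_Measure"
begin

text \<open>
  The classical (Rokhlin) notion: a complete probability space that is isomorphic modulo
  null sets to \<open>[0,1]\<close> with Lebesgue measure. Atoms need not be allowed for: an infinite
  group has no free measure preserving action on a probability space with atoms.
\<close>

definition lebesgue_probability_space :: "'a measure \<Rightarrow> bool" where
  "lebesgue_probability_space M \<longleftrightarrow>
     prob_space M \<and> complete_measure M \<and>
     (\<exists>N\<in>null_sets M. \<exists>N'\<in>null_sets (lebesgue_on {0..1::real}). \<exists>\<phi>.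
        bij_betw \<phi> (space M - N) ({0..1} - N') \<and>
        \<phi> \<in> restrict_space M (space M - N) \<rightarrow>\<^sub>M lebesgue_on ({0..1} - N') \<and>
        the_inv_into (space M - N) \<phi>
          \<in> lebesgue_on ({0..1} - N') \<rightarrow>\<^sub>M restrict_space M (space M - N) \<and>
        distr (restrict_space M (space M - N)) (lebesgue_on ({0..1} - N')) \<phi>
          = lebesgue_on ({0..1} - N'))"

definition integer_lattice :: "(real ^ 'n) set" where
  "integer_lattice = {v. \<forall>i. v $ i \<in> \<int>}"

text \<open>
  A free measurable measure preserving action of a closed subgroup \<open>G\<close> of \<open>\<real>\<^sup>d\<close>, where \<open>G\<close> is
  given by a Haar measure \<open>\<nu>\<close> with \<open>space \<nu> = G\<close>; the values of \<open>T\<close> outside \<open>G\<close> are irrelevant.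
  As \<open>M\<close> is complete, joint measurability has to be taken with respect to the completed product.
  Freeness means that almost every point has trivial stabilizer.
\<close>

definition free_mp_action ::
    "(real ^ 'n) measure \<Rightarrow> 'a measure \<Rightarrow> (real ^ 'n \<Rightarrow> 'a \<Rightarrow> 'a) \<Rightarrow> bool" where
  "free_mp_action \<nu> M T \<longleftrightarrow>
     (\<forall>x\<in>space M. T 0 x = x) \<and>
     (\<forall>g\<in>space \<nu>. \<forall>h\<in>space \<nu>. \<forall>x\<in>space M. T (g + h) x = T g (T h x)) \<and>
     (\<lambda>(g, x). T g x) \<in> completion (\<nu> \<Otimes>\<^sub>M M) \<rightarrow>\<^sub>M M \<and>
     (\<forall>g\<in>space \<nu>. T g \<in> M \<rightarrow>\<^sub>M M \<and> distr M M (T g) = M) \<and>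
     (AE x in M. \<forall>g\<in>space \<nu>. T g x = x \<longrightarrow> g = 0)"

abbreviation free_Rd_action :: "'a measure \<Rightarrow> (real ^ 'n \<Rightarrow> 'a \<Rightarrow> 'a) \<Rightarrow> bool" where
  "free_Rd_action \<equiv> free_mp_action lborel"

abbreviation free_Zd_action :: "'a measure \<Rightarrow> (real ^ 'n \<Rightarrow> 'a \<Rightarrow> 'a) \<Rightarrow> bool" where
  "free_Zd_action \<equiv> free_mp_action (count_space integer_lattice)"

text \<open>Square integrable functions themselves, not their classes modulo null sets.\<close>

definition L2 :: "'a measure \<Rightarrow> ('a \<Rightarrow> complex) set" where
  "L2 M = {f \<in> borel_measurable M. integrable M (\<lambda>x. (cmod (f x))\<^sup>2)}"

definition L2_inner :: "'a measure \<Rightarrow> ('a \<Rightarrow> complex) \<Rightarrow> ('a \<Rightarrow> complex) \<Rightarrow> complex" where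
  "L2_inner M f g = (LINT x|M. f x * cnj (g x))"

definition L2_orthogonal_complement :: "'a measure \<Rightarrow> ('a \<Rightarrow> complex) set \<Rightarrow> ('a \<Rightarrow> complex) set" where
  "L2_orthogonal_complement M V = {f \<in> L2 M. \<forall>g\<in>V. L2_inner M f g = 0}"

definition koopman :: "('g \<Rightarrow> 'a \<Rightarrow> 'a) \<Rightarrow> 'g \<Rightarrow> ('a \<Rightarrow> complex) \<Rightarrow> ('a \<Rightarrow> complex)" where
  "koopman T g f = (\<lambda>x. f (T g x))"

text \<open>
  The filter of \<open>g \<rightarrow> \<infinity>\<close> in \<open>G\<close>: for a closed subset \<open>G\<close> of \<open>\<real>\<^sup>d\<close>, leaving all compact subsets
  of \<open>G\<close> is the same as \<open>norm g \<rightarrow> \<infinity>\<close> with \<open>g \<in> G\<close>.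
\<close>

definition infinity_in :: "(real ^ 'n) set \<Rightarrow> (real ^ 'n) filter" where
  "infinity_in G = inf at_infinity (principal G)"

definition strong_mixing ::
    "(real ^ 'n) set \<Rightarrow> 'a measure \<Rightarrow> (real ^ 'n \<Rightarrow> 'a \<Rightarrow> 'a) \<Rightarrow> bool" where
  "strong_mixing G M T \<longleftrightarrow>
     (\<forall>f\<in>L2 M. (LINT x|M. f x) = 0 \<longrightarrow>
        ((\<lambda>g. L2_inner M (koopman T g f) f) \<longlongrightarrow> 0) (infinity_in G))"

definition grassmannian :: "nat \<Rightarrow> (real ^ 'n) set set" where
  "grassmannian e = {L. subspace L \<and> dim L = e}"

definition strong_mixing_in_direction_Rd ::
    "'a measure \<Rightarrow> (real ^ 'n \<Rightarrow> 'a \<Rightarrow> 'a) \<Rightarrow> (real ^ 'n) set \<Rightarrow> bool" where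
  "strong_mixing_in_direction_Rd M T L \<longleftrightarrow> strong_mixing L M T"

definition vfloor :: "real ^ 'n \<Rightarrow> real ^ 'n" where
  "vfloor v = (\<chi> i. of_int \<lfloor>v $ i\<rfloor>)"

definition vfrac :: "real ^ 'n \<Rightarrow> real ^ 'n" where
  "vfrac v = (\<chi> i. frac (v $ i))"

definition unit_cube :: "(real ^ 'n) set" where
  "unit_cube = {r. \<forall>i. 0 \<le> r $ i \<and> r $ i < 1}"

text \<open>
  The suspension space carries the completed product measure, so that it is again complete;
  up to null sets this does not change the square integrable functions.
\<close>

definition suspension_space :: "'a measure \<Rightarrow> ('a \<times> (real ^ 'n)) measure" where
  "suspension_space M = completion (M \<Otimes>\<^sub>M lebesgue_on unit_cube)"

definition suspension ::
    "(real ^ 'n \<Rightarrow> 'a \<Rightarrow> 'a) \<Rightarrow> real ^ 'n \<Rightarrow> 'a \<times> (real ^ 'n) \<Rightarrow> 'a \<times> (real ^ 'n)" where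
  "suspension T t = (\<lambda>(x, r). (T (vfloor (t + r)) x, vfrac (t + r)))"

definition cube_functions :: "('a \<times> (real ^ 'n) \<Rightarrow> complex) set" where
  "cube_functions = {F. \<exists>f\<in>L2 (lebesgue_on unit_cube). F = (\<lambda>(x, s). f s)}"

definition L2_O :: "'a measure \<Rightarrow> ('a \<times> (real ^ 'n) \<Rightarrow> complex) set" where
  "L2_O M = L2_orthogonal_complement (suspension_space M) cube_functions"

definition strong_mixing_in_direction_Zd ::
    "'a measure \<Rightarrow> (real ^ 'n \<Rightarrow> 'a \<Rightarrow> 'a) \<Rightarrow> (real ^ 'n) set \<Rightarrow> bool" where
  "strong_mixing_in_direction_Zd M T L \<longleftrightarrow>
     (\<forall>f\<in>L2_O M.
        ((\<lambda>t. L2_inner (suspension_space M) (koopman (suspension T) t f) f) \<longlongrightarrow> 0)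
          (infinity_in L))"

end

theory Submission
  imports Defs
begin

text \<open>
  For \<open>\<real>\<^sup>d\<close> there is nothing to do but to restrict a limit: going to infinity inside a subspace
  \<open>L\<close> is a special way of going to infinity in \<open>\<real>\<^sup>d\<close>.

  For \<open>\<int>\<^sup>d\<close> the correlations of the suspension decay along every \<open>t \<rightarrow> \<infinity>\<close> in \<open>\<real>\<^sup>d\<close>, not only
  along \<open>L\<close>. Let \<open>G\<close> be orthogonal to the functions of the cube coordinate, so that almost every
  section \<open>G\<^sub>r = G(\<cdot>, r)\<close> has integral \<open>0\<close> (\<open>L2_O_version\<close>). The obvious computation
  \<open>(U\<^sup>t G, G) = \<integral> (U\<^sub>T\<^sup>n G\<^sub>s, G\<^sub>r) dr\<close>, where \<open>n = \<lfloor>t + r\<rfloor>\<close> and \<open>s = {t + r}\<close>, does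
  not settle the matter at once: the function on the left in the inner product varies with
  \<open>t\<close>, so that mixing of \<open>T\<close> does not give the pointwise convergence of the integrand.
  It does so if the left-hand \<open>G\<close> is replaced by the indicator of a rectangle \<open>A \<times> B\<close>, since
  the integrand is then \<open>1\<^sub>B({t + r}) (U\<^sub>T\<^sup>n 1\<^sub>A, G\<^sub>r)\<close> with \<open>n = \<lfloor>t + r\<rfloor> \<rightarrow> \<infinity>\<close>; dominated
  convergence applies (\<open>suspension_rectangle_correlations_decay\<close>). The set of all \<open>F\<close> for which
  \<open>(U\<^sup>t F, G) \<rightarrow> 0\<close> is a subspace, closed in \<open>L\<^sup>2\<close> because the suspension preserves the measure.
  Rectangles generate the product \<open>\<sigma>\<close>-algebra, so this subspace is everything
  (\<open>correlations_decay_from_generator\<close>), and \<open>F = G\<close> is allowed.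

  Mixing is defined through \<open>(U\<^sup>g f, f)\<close> only; the mixed correlations used above come from
  polarization over \<open>\<complex>\<close> (\<open>strong_mixing_correlations\<close>). Dominated convergence being a theorem on
  sequences, \<open>t \<rightarrow> \<infinity>\<close> is tested along sequences (\<open>tendsto_at_infinityI_sequentially\<close>).
\<close>

section \<open>Square integrable functions\<close>

lemma cmod_mult_cnj_le:
  assumes "c > 0"
  shows "cmod (a * cnj b) \<le> ((cmod a)\<^sup>2 / c + c * (cmod b)\<^sup>2) / 2"
proof -
  have "0 \<le> (cmod a - c * cmod b)\<^sup>2" by simp
  then have "2 * c * (cmod a * cmod b) \<le> (cmod a)\<^sup>2 + c\<^sup>2 * (cmod b)\<^sup>2"
    by (simp add: power2_eq_square algebra_simps)
  with assms show ?thesis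
    by (simp add: norm_mult field_simps power2_eq_square)
qed

lemma cmod_add_squared_le: "(cmod (a + b))\<^sup>2 \<le> 2 * (cmod a)\<^sup>2 + 2 * (cmod b)\<^sup>2"
proof -
  have "(cmod (a + b))\<^sup>2 \<le> (cmod a + cmod b)\<^sup>2"
    by (intro power_mono norm_triangle_ineq) auto
  also have "\<dots> \<le> 2 * (cmod a)\<^sup>2 + 2 * (cmod b)\<^sup>2"
    using sum_squares_bound[of "cmod a" "cmod b"] by (simp add: power2_sum)
  finally show ?thesis .
qed

lemma borel_measurable_cnj [measurable]: "cnj \<in> borel_measurable borel"
  by (intro borel_measurable_continuous_onI continuous_intros)

lemma L2_measurable [measurable_dest]: "f \<in> L2 M \<Longrightarrow> f \<in> borel_measurable M"
  by (simp add: L2_def)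

lemma L2_integrable: "f \<in> L2 M \<Longrightarrow> integrable M (\<lambda>x. (cmod (f x))\<^sup>2)"
  by (simp add: L2_def)

lemma L2_dominated:
  assumes "f \<in> borel_measurable M" "integrable M w" "\<And>x. x \<in> space M \<Longrightarrow> (cmod (f x))\<^sup>2 \<le> w x"
  shows "f \<in> L2 M"
  unfolding L2_def
proof (intro CollectI conjI assms(1))
  note [measurable] = assms(1)
  show "integrable M (\<lambda>x. (cmod (f x))\<^sup>2)"
    by (rule Bochner_Integration.integrable_bound[OF assms(2)])
       (use assms(3) in \<open>auto intro!: AE_I2 intro: order_trans[OF _ abs_ge_self]\<close>)
qed

lemma L2_add:
  assumes "f \<in> L2 M" "g \<in> L2 M"
  shows "(\<lambda>x. f x + g x) \<in> L2 M"
proof (rule L2_dominated)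
  note [measurable] = assms
  show "(\<lambda>x. f x + g x) \<in> borel_measurable M" by measurable
  show "integrable M (\<lambda>x. 2 * (cmod (f x))\<^sup>2 + 2 * (cmod (g x))\<^sup>2)"
    using assms[THEN L2_integrable] by auto
qed (rule cmod_add_squared_le)

lemma L2_cmult:
  assumes "f \<in> L2 M"
  shows "(\<lambda>x. c * f x) \<in> L2 M"
proof (rule L2_dominated)
  note [measurable] = assms
  show "(\<lambda>x. c * f x) \<in> borel_measurable M" by measurable
  show "integrable M (\<lambda>x. (cmod c)\<^sup>2 * (cmod (f x))\<^sup>2)"
    using assms[THEN L2_integrable] by auto
qed (simp add: norm_mult power_mult_distrib)

lemma L2_diff:
  assumes "f \<in> L2 M" "g \<in> L2 M"
  shows "(\<lambda>x. f x - g x) \<in> L2 M"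
  using L2_add[OF assms(1) L2_cmult[OF assms(2), of "-1"]] by simp

lemma L2_sum:
  assumes "\<And>i. i \<in> I \<Longrightarrow> f i \<in> L2 M"
  shows "(\<lambda>x. \<Sum>i\<in>I. f i x) \<in> L2 M"
  using assms
proof (induction I rule: infinite_finite_induct)
  case (insert i I)
  then show ?case using L2_add[of "f i" M "\<lambda>x. \<Sum>i\<in>I. f i x"] by simp
qed (auto simp: L2_def)

lemma (in finite_measure) L2_bounded:
  assumes "f \<in> borel_measurable M" "\<And>x. x \<in> space M \<Longrightarrow> cmod (f x) \<le> B"
  shows "f \<in> L2 M"
  by (rule L2_dominated[OF assms(1), of "\<lambda>_. B\<^sup>2"]) (use assms in \<open>auto intro: power_mono\<close>)

lemma L2_inner_integrable:
  assumes "f \<in> L2 M" "g \<in> L2 M"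
  shows "integrable M (\<lambda>x. f x * cnj (g x))"
proof (rule Bochner_Integration.integrable_bound)
  note [measurable] = assms
  show "integrable M (\<lambda>x. ((cmod (f x))\<^sup>2 / 1 + 1 * (cmod (g x))\<^sup>2) / 2)"
    using assms[THEN L2_integrable] by auto
  show "(\<lambda>x. f x * cnj (g x)) \<in> borel_measurable M" by measurable
  show "AE x in M. norm (f x * cnj (g x)) \<le> norm (((cmod (f x))\<^sup>2 / 1 + 1 * (cmod (g x))\<^sup>2) / 2)"
    using cmod_mult_cnj_le[of 1] by (intro AE_I2) (smt (verit) real_norm_def)
qed

lemma (in finite_measure) L2_imp_integrable:
  assumes "f \<in> L2 M"
  shows "integrable M f"
  using L2_inner_integrable[OF assms L2_bounded[of "\<lambda>_. 1" 1]] by simp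

text \<open>
  Young's inequality with a free weight \<open>c\<close>, a substitute for the Cauchy--Schwarz inequality: to make
  the inner product small, one first fixes \<open>c\<close> in terms of \<open>g\<close> and then makes \<open>f\<close> small.
\<close>
lemma cmod_L2_inner_le:
  assumes "f \<in> L2 M" "g \<in> L2 M" "c > 0"
  shows "cmod (L2_inner M f g) \<le> ((LINT x|M. (cmod (f x))\<^sup>2) / c + c * (LINT x|M. (cmod (g x))\<^sup>2)) / 2"
proof -
  have "cmod (L2_inner M f g) \<le> (LINT x|M. cmod (f x * cnj (g x)))"
    unfolding L2_inner_def by (rule integral_norm_bound)
  also have "\<dots> \<le> (LINT x|M. ((cmod (f x))\<^sup>2 / c + c * (cmod (g x))\<^sup>2) / 2)"
    using assms L2_inner_integrable[OF assms(1,2)] assms(1,2)[THEN L2_integrable]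
    by (intro integral_mono cmod_mult_cnj_le) auto
  also have "\<dots> = ((LINT x|M. (cmod (f x))\<^sup>2) / c + c * (LINT x|M. (cmod (g x))\<^sup>2)) / 2"
    using assms(1,2)[THEN L2_integrable] by simp
  finally show ?thesis .
qed

lemma L2_inner_add_left:
  assumes "f \<in> L2 M" "g \<in> L2 M" "h \<in> L2 M"
  shows "L2_inner M (\<lambda>x. f x + g x) h = L2_inner M f h + L2_inner M g h"
  using L2_inner_integrable[OF assms(1,3)] L2_inner_integrable[OF assms(2,3)]
  by (simp add: L2_inner_def distrib_right)

lemma L2_inner_cmult_left:
  "L2_inner M (\<lambda>x. c * f x) h = c * L2_inner M f h"
  by (simp add: L2_inner_def mult.assoc)

section \<open>Measure preserving maps and decay of correlations\<close>

definition measure_preserving_map :: "'a measure \<Rightarrow> ('a \<Rightarrow> 'a) \<Rightarrow> bool" where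
  "measure_preserving_map M S \<longleftrightarrow> S \<in> M \<rightarrow>\<^sub>M M \<and> distr M M S = M"

lemma measure_preserving_map_integral:
  fixes f :: "'a \<Rightarrow> 'b::{banach, second_countable_topology}"
  assumes "measure_preserving_map M S" "f \<in> borel_measurable M"
  shows "(LINT x|M. f (S x)) = (LINT x|M. f x)"
  using integral_distr[of S M M f] assms by (simp add: measure_preserving_map_def)

lemma measure_preserving_map_integrable:
  fixes f :: "'a \<Rightarrow> 'b::{banach, second_countable_topology}"
  assumes "measure_preserving_map M S" "integrable M f"
  shows "integrable M (\<lambda>x. f (S x))"
  using integrable_distr[of S M M f] assms by (simp add: measure_preserving_map_def)

lemma measure_preserving_map_measurable:
  "measure_preserving_map M S \<Longrightarrow> S \<in> M \<rightarrow>\<^sub>M M"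
  by (simp add: measure_preserving_map_def)

lemma L2_compose:
  assumes "measure_preserving_map M S" "f \<in> L2 M"
  shows "(\<lambda>x. f (S x)) \<in> L2 M"
proof -
  have "(\<lambda>x. f (S x)) \<in> borel_measurable M"
    by (rule measurable_compose[OF measure_preserving_map_measurable[OF assms(1)] L2_measurable[OF assms(2)]])
  then show ?thesis
    using measure_preserving_map_integrable[OF assms(1) L2_integrable[OF assms(2)]]
    by (simp add: L2_def)
qed

text \<open>
  The approximation is uniform in \<open>k\<close>: composing with \<open>S k\<close> does not change the \<open>L\<^sup>2\<close> norm of
  \<open>F - Fj j\<close>.
\<close>
lemma correlations_decay_L2_limit:
  fixes S :: "nat \<Rightarrow> 'a \<Rightarrow> 'a"
  assumes S: "\<And>k. measure_preserving_map M (S k)"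
    and G: "G \<in> L2 M" and F: "F \<in> L2 M" and Fj: "\<And>j. Fj j \<in> L2 M"
    and lim: "(\<lambda>j::nat. LINT x|M. (cmod (F x - Fj j x))\<^sup>2) \<longlonglongrightarrow> 0"
    and decay: "\<And>j. (\<lambda>k. L2_inner M (\<lambda>x. Fj j (S k x)) G) \<longlonglongrightarrow> 0"
  shows "(\<lambda>k. L2_inner M (\<lambda>x. F (S k x)) G) \<longlonglongrightarrow> 0"
proof (rule LIMSEQ_I)
  fix \<epsilon> :: real assume \<epsilon>: "\<epsilon> > 0"
  define I where "I = (LINT x|M. (cmod (G x))\<^sup>2)"
  have I: "I \<ge> 0" by (simp add: I_def)
  define c where "c = \<epsilon> / (2 * (1 + I))"
  have c: "c > 0" using \<epsilon> I by (simp add: c_def)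
  have cI: "c * I \<le> \<epsilon> / 2" using \<epsilon> I by (simp add: c_def field_simps)
  obtain j where j: "(LINT x|M. (cmod (F x - Fj j x))\<^sup>2) < c * \<epsilon> / 2"
  proof -
    have "eventually (\<lambda>j. (LINT x|M. (cmod (F x - Fj j x))\<^sup>2) < c * \<epsilon> / 2) sequentially"
      using order_tendstoD(2)[OF lim, of "c * \<epsilon> / 2"] c \<epsilon> by simp
    then show ?thesis using that eventually_sequentially by auto
  qed
  obtain K where K: "\<And>k. k \<ge> K \<Longrightarrow> cmod (L2_inner M (\<lambda>x. Fj j (S k x)) G) < \<epsilon> / 2"
    using LIMSEQ_D[OF decay[of j], of "\<epsilon> / 2"] \<epsilon> by auto
  have D: "(\<lambda>x. F x - Fj j x) \<in> L2 M" by (rule L2_diff[OF F Fj])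
  have "cmod (L2_inner M (\<lambda>x. F (S k x)) G) < \<epsilon>" if "k \<ge> K" for k
  proof -
    have "L2_inner M (\<lambda>x. F (S k x)) G
        = L2_inner M (\<lambda>x. Fj j (S k x)) G + L2_inner M (\<lambda>x. F (S k x) - Fj j (S k x)) G"
      using L2_inner_add_left[OF L2_compose[OF S[of k] Fj[of j]] L2_compose[OF S[of k] D] G] by simp
    moreover have "cmod (L2_inner M (\<lambda>x. F (S k x) - Fj j (S k x)) G) \<le> \<epsilon> / 2"
    proof -
      have "cmod (L2_inner M (\<lambda>x. F (S k x) - Fj j (S k x)) G)
          \<le> ((LINT x|M. (cmod (F (S k x) - Fj j (S k x)))\<^sup>2) / c + c * I) / 2"
        unfolding I_def by (rule cmod_L2_inner_le[OF L2_compose[OF S[of k] D] G c])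
      also have "(LINT x|M. (cmod (F (S k x) - Fj j (S k x)))\<^sup>2) = (LINT x|M. (cmod (F x - Fj j x))\<^sup>2)"
      proof -
        note [measurable] = F Fj
        show ?thesis
          by (rule measure_preserving_map_integral[OF S, of "\<lambda>x. (cmod (F x - Fj j x))\<^sup>2"]) measurable
      qed
      also have "((LINT x|M. (cmod (F x - Fj j x))\<^sup>2) / c + c * I) / 2 \<le> (\<epsilon> / 2 + \<epsilon> / 2) / 2"
        using j c cI by (intro divide_right_mono add_mono) (auto simp: field_simps)
      finally show ?thesis by simp
    qed
    ultimately show ?thesis
      using K[OF that] norm_triangle_ineq[of "L2_inner M (\<lambda>x. Fj j (S k x)) G"
          "L2_inner M (\<lambda>x. F (S k x) - Fj j (S k x)) G"] by simp
  qed
  then show "\<exists>K. \<forall>k\<ge>K. norm (L2_inner M (\<lambda>x. F (S k x)) G - 0) < \<epsilon>" by auto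
qed

lemma simple_function_complex_representation:
  fixes f :: "'a \<Rightarrow> complex"
  assumes "simple_function M f" "x \<in> space M"
  shows "f x = (\<Sum>y\<in>f ` space M. y * indicator (f -` {y} \<inter> space M) x)"
proof -
  have "(\<Sum>y\<in>f ` space M. y * indicator (f -` {y} \<inter> space M) x)
      = (\<Sum>y\<in>f ` space M. if y = f x then y else 0)"
    using assms(2) by (intro sum.cong) (auto simp: indicator_def)
  also have "\<dots> = f x"
    using assms simple_functionD(1)[OF assms(1)] by (simp add: sum.delta)
  finally show ?thesis by simp
qed

text \<open>
  The functions whose correlations with \<open>G\<close> decay form an \<open>L\<^sup>2\<close>-closed subspace, which contains the
  constants since \<open>G\<close> has integral \<open>0\<close>. Hence the sets whose indicator lies in it form a Dynkin
  system, and by density of the simple functions nothing is left out once this Dynkin system is the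
  whole \<open>\<sigma>\<close>-algebra.
\<close>
lemma (in prob_space) correlations_decay_from_generator:
  fixes S :: "nat \<Rightarrow> 'a \<Rightarrow> 'a"
  assumes S: "\<And>k. measure_preserving_map M (S k)"
    and G: "G \<in> L2 M" and G0: "(LINT x|M. G x) = 0"
    and gen: "sets M = sigma_sets (space M) \<E>" "Int_stable \<E>" "\<E> \<subseteq> Pow (space M)"
    and base: "\<And>A. A \<in> \<E> \<Longrightarrow> (\<lambda>k. L2_inner M (\<lambda>x. indicator A (S k x)) G) \<longlonglongrightarrow> 0"
    and F: "F \<in> L2 M"
  shows "(\<lambda>k. L2_inner M (\<lambda>x. F (S k x)) G) \<longlonglongrightarrow> 0"
proof -
  define dec :: "('a \<Rightarrow> complex) \<Rightarrow> bool"
    where "dec F \<longleftrightarrow> (\<lambda>k. L2_inner M (\<lambda>x. F (S k x)) G) \<longlonglongrightarrow> 0" for F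
  have S_meas [measurable]: "S k \<in> M \<rightarrow>\<^sub>M M" for k
    by (rule measure_preserving_map_measurable[OF S])
  have S_space: "S k x \<in> space M" if "x \<in> space M" for k x
    using measurable_space[OF S_meas that] .
  have ind_L2: "(indicator A :: 'a \<Rightarrow> complex) \<in> L2 M" if [measurable]: "A \<in> sets M" for A
    by (rule L2_bounded[of _ 1]) (auto simp: indicator_def)
  have dec_add: "dec (\<lambda>x. f x + g x)" if "f \<in> L2 M" "g \<in> L2 M" "dec f" "dec g" for f g
    using tendsto_add[OF that(3,4)[unfolded dec_def]]
      L2_inner_add_left[OF L2_compose[OF S that(1)] L2_compose[OF S that(2)] G]
    by (simp add: dec_def)
  have dec_cmult: "dec (\<lambda>x. c * f x)" if "dec f" for f c
    using tendsto_mult_left[OF that[unfolded dec_def], of c] by (simp add: dec_def L2_inner_cmult_left)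
  have dec_sum: "dec (\<lambda>x. \<Sum>i\<in>I. f i x)" if "\<And>i. i \<in> I \<Longrightarrow> f i \<in> L2 M \<and> dec (f i)"
    for f and I :: "'c set"
    using that
  proof (induction I rule: infinite_finite_induct)
    case (insert i I)
    then show ?case using dec_add[of "f i" "\<lambda>x. \<Sum>i\<in>I. f i x"] L2_sum[of I f M] by simp
  qed (auto simp: dec_def L2_inner_def)
  have dec_cong: "dec f \<longleftrightarrow> dec g" if "\<And>x. x \<in> space M \<Longrightarrow> f x = g x" for f g
  proof -
    have "L2_inner M (\<lambda>x. f (S k x)) G = L2_inner M (\<lambda>x. g (S k x)) G" for k
      unfolding L2_inner_def by (rule Bochner_Integration.integral_cong) (auto simp: that S_space)
    then show ?thesis by (simp add: dec_def)
  qed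
  have dec_one: "dec (\<lambda>_. 1)"
  proof -
    have "(LINT x|M. cnj (G x)) = cnj (LINT x|M. G x)" by simp
    then show ?thesis using G0 by (simp add: dec_def L2_inner_def)
  qed
  have dec_ind: "dec (indicator A)" if "A \<in> sets M" for A
    using gen(2,3) that[unfolded gen(1)]
  proof (induction rule: sigma_sets_induct_disjoint)
    case (basic A)
    then show ?case using base by (simp add: dec_def)
  next
    case empty
    then show ?case by (simp add: dec_def L2_inner_def)
  next
    case (compl A)
    then have "dec (\<lambda>x. 1 + (-1) * indicator A x)"
      using gen(1) by (intro dec_add dec_one dec_cmult L2_cmult ind_L2 L2_bounded[of _ 1]) auto
    then show ?case by (subst dec_cong[of _ "\<lambda>x. 1 + (-1) * indicator A x"]) (auto simp: indicator_def)
  next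
    case (union A)
    then have A [measurable]: "A i \<in> sets M" for i using gen(1) by auto
    \<comment> \<open>The finite partial unions converge in \<open>L\<^sup>2\<close> to the union.\<close>
    let ?s = "\<lambda>j x. \<Sum>i<j. indicator (A i) x :: complex"
    have s_eq: "?s j x = indicator (\<Union>i<j. A i) x" for j x
      using union(1)
      by (subst indicator_UN_disjoint) (auto simp: disjoint_family_on_def)
    show ?case unfolding dec_def
    proof (rule correlations_decay_L2_limit[OF S G, of _ ?s])
      show "(indicator (\<Union>i. A i) :: 'a \<Rightarrow> complex) \<in> L2 M" by (rule ind_L2) auto
      show "?s j \<in> L2 M" for j by (rule L2_sum) (auto intro: ind_L2)
      show "(\<lambda>k. L2_inner M (\<lambda>x. ?s j (S k x)) G) \<longlonglongrightarrow> 0" for j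
        using dec_sum[of "{..<j}" "\<lambda>i. indicator (A i)"] ind_L2 union(3) by (simp add: dec_def)
      have "(\<lambda>j. LINT x|M. (cmod (indicator (\<Union>i. A i) x - ?s j x))\<^sup>2) \<longlonglongrightarrow> (LINT x|M. 0)"
      proof (rule integral_dominated_convergence[where w = "\<lambda>_. 1"])
        show "AE x in M. (\<lambda>j. (cmod (indicator (\<Union>i. A i) x - ?s j x))\<^sup>2) \<longlonglongrightarrow> 0"
        proof (intro AE_I2)
          fix x
          have "(\<lambda>j. indicator (\<Union>i<j. A i) x :: complex) \<longlonglongrightarrow> indicator (\<Union>i. A i) x"
            by (rule LIMSEQ_indicator_UN)
          then have "(\<lambda>j. indicator (\<Union>i. A i) x - indicator (\<Union>i<j. A i) x :: complex) \<longlonglongrightarrow> 0"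
            using tendsto_diff[OF tendsto_const[of "indicator (\<Union>i. A i) x :: complex"]] by fastforce
          from tendsto_power[OF tendsto_norm[OF this], of 2]
          show "(\<lambda>j. (cmod (indicator (\<Union>i. A i) x - ?s j x))\<^sup>2) \<longlonglongrightarrow> 0"
            by (simp add: s_eq)
        qed
        show "AE x in M. norm ((cmod (indicator (\<Union>i. A i) x - ?s j x))\<^sup>2) \<le> 1" for j
          by (intro AE_I2, simp only: s_eq) (auto simp: indicator_def)
      qed (auto simp: s_eq)
      then show "(\<lambda>j. LINT x|M. (cmod (indicator (\<Union>i. A i) x - ?s j x))\<^sup>2) \<longlonglongrightarrow> 0" by simp
    qed
  qed
  have dec_simple: "dec f" if f: "simple_function M f" for f
  proof -
    have "f -` {y} \<inter> space M \<in> sets M" for y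
      using simple_functionD(2)[OF f] .
    then have "dec (\<lambda>x. \<Sum>y\<in>f ` space M. y * indicator (f -` {y} \<inter> space M) x)"
      by (intro dec_sum conjI L2_cmult dec_cmult ind_L2 dec_ind)
    then show ?thesis
      by (subst dec_cong[OF simple_function_complex_representation[OF f]])
  qed
  from borel_measurable_implies_sequence_metric[OF L2_measurable[OF F], of 0] obtain s where
    s: "\<And>i. simple_function M (s i)" "\<And>x. x \<in> space M \<Longrightarrow> (\<lambda>i. s i x) \<longlonglongrightarrow> F x"
       "\<And>i x. x \<in> space M \<Longrightarrow> cmod (s i x) \<le> 2 * cmod (F x)"
    unfolding dist_0_norm dist_norm diff_0_right by metis
  note [measurable] = F borel_measurable_simple_function[OF s(1)]
  have s_le: "(cmod (s i x))\<^sup>2 \<le> 4 * (cmod (F x))\<^sup>2" if "x \<in> space M" for i x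
    using power_mono[OF s(3)[OF that], where n = 2] by (simp add: power_mult_distrib)
  \<comment> \<open>As \<open>\<bar>s j\<bar> \<le> 2 \<bar>F\<bar>\<close>, the integrand \<open>\<bar>F - s j\<bar>\<^sup>2\<close> is at most \<open>2 \<bar>F\<bar>\<^sup>2 + 2 (2 \<bar>F\<bar>)\<^sup>2 = 10 \<bar>F\<bar>\<^sup>2\<close>.\<close>
  show ?thesis
  proof (rule correlations_decay_L2_limit[OF S G F, of s])
    show "s j \<in> L2 M" for j
      by (rule L2_dominated[OF _ _ s_le]) (use L2_integrable[OF F] in auto)
    show "(\<lambda>k. L2_inner M (\<lambda>x. s j (S k x)) G) \<longlonglongrightarrow> 0" for j
      using dec_simple[OF s(1)] by (simp add: dec_def)
    have "(\<lambda>j. LINT x|M. (cmod (F x - s j x))\<^sup>2) \<longlonglongrightarrow> (LINT x|M. 0)"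
    proof (rule integral_dominated_convergence[where w = "\<lambda>x. 10 * (cmod (F x))\<^sup>2"])
      show "integrable M (\<lambda>x. 10 * (cmod (F x))\<^sup>2)" using L2_integrable[OF F] by simp
      show "AE x in M. (\<lambda>j. (cmod (F x - s j x))\<^sup>2) \<longlonglongrightarrow> 0"
      proof (intro AE_I2)
        fix x assume "x \<in> space M"
        from tendsto_power[OF tendsto_norm[OF tendsto_diff[OF tendsto_const[of "F x"] s(2)[OF this]]], of 2]
        show "(\<lambda>j. (cmod (F x - s j x))\<^sup>2) \<longlonglongrightarrow> 0" by simp
      qed
      show "AE x in M. norm ((cmod (F x - s j x))\<^sup>2) \<le> 10 * (cmod (F x))\<^sup>2" for j
      proof (intro AE_I2)
        fix x assume x: "x \<in> space M"
        show "norm ((cmod (F x - s j x))\<^sup>2) \<le> 10 * (cmod (F x))\<^sup>2"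
          using cmod_add_squared_le[of "F x" "- s j x"] s_le[OF x, of j] by simp
      qed
    qed measurable
    then show "(\<lambda>j. LINT x|M. (cmod (F x - s j x))\<^sup>2) \<longlonglongrightarrow> 0" by simp
  qed
qed

section \<open>Mixing in terms of pairs of functions\<close>

text \<open>
  Expanding the right-hand side, the terms other than \<open>(U f, g)\<close> carry the factors
  \<open>\<Sum> c = 0\<close>, \<open>\<Sum> c\<^sup>2 = 0\<close> and \<open>\<Sum> c \<bar>c\<bar>\<^sup>2 = 0\<close>. That fourth roots of unity separate \<open>(U f, g)\<close>
  from \<open>(U g, f)\<close> is the reason for complex scalars; with \<open>c = \<plusminus>1\<close> one only gets their sum.
\<close>
lemma L2_inner_polarization:
  assumes S: "measure_preserving_map M S" and f: "f \<in> L2 M" and g: "g \<in> L2 M"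
  shows "4 * L2_inner M (\<lambda>x. f (S x)) g
    = (\<Sum>c\<in>{1, -1, \<i>, -\<i>}. c * L2_inner M (\<lambda>x. f (S x) + c * g (S x)) (\<lambda>x. f x + c * g x))"
proof -
  let ?h = "\<lambda>c x. f x + c * g x"
  have h: "?h c \<in> L2 M" for c by (intro L2_add L2_cmult f g)
  have int: "integrable M (\<lambda>x. ?h c (S x) * cnj (?h c x))" for c
    by (rule L2_inner_integrable[OF L2_compose[OF S h] h])
  have distinct: "\<i> \<noteq> 1" "\<i> \<noteq> -1" "\<i> \<noteq> -\<i>" "1 \<noteq> -\<i>" "-1 \<noteq> -\<i>" "(1::complex) \<noteq> -1"
    by (auto simp: complex_eq_iff)
  have "(\<Sum>c\<in>{1, -1, \<i>, -\<i>}. c * L2_inner M (\<lambda>x. ?h c (S x)) (?h c))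
      = (\<Sum>c\<in>{1, -1, \<i>, -\<i>}. LINT x|M. c * (?h c (S x) * cnj (?h c x)))"
    unfolding L2_inner_def by (intro sum.cong refl) (rule integral_mult_right_zero[symmetric])
  also have "\<dots> = (LINT x|M. (\<Sum>c\<in>{1, -1, \<i>, -\<i>}. c * (?h c (S x) * cnj (?h c x))))"
    by (rule Bochner_Integration.integral_sum[symmetric]) (intro integrable_mult_right int)
  also have "\<dots> = (LINT x|M. 4 * (f (S x) * cnj (g x)))"
    by (intro Bochner_Integration.integral_cong refl) (use distinct in \<open>simp add: algebra_simps\<close>)
  also have "\<dots> = 4 * L2_inner M (\<lambda>x. f (S x)) g"
    unfolding L2_inner_def by (rule integral_mult_right_zero)
  finally show ?thesis by simp
qed

lemma eventually_infinity_in: "eventually (\<lambda>g. g \<in> G) (infinity_in G)"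
  unfolding infinity_in_def by (intro filter_leD[OF inf_le2]) (simp add: eventually_principal)

lemma (in finite_measure) strong_mixing_correlations:
  assumes mix: "strong_mixing \<Gamma> M T"
    and mp: "\<And>g. g \<in> \<Gamma> \<Longrightarrow> measure_preserving_map M (T g)"
    and f: "f \<in> L2 M" "(LINT x|M. f x) = 0" and g: "g \<in> L2 M" "(LINT x|M. g x) = 0"
  shows "((\<lambda>n. L2_inner M (\<lambda>x. f (T n x)) g) \<longlongrightarrow> 0) (infinity_in \<Gamma>)"
proof -
  let ?h = "\<lambda>c x. f x + c * g x"
  have h: "?h c \<in> L2 M" for c by (intro L2_add L2_cmult f g)
  have "(LINT x|M. ?h c x) = 0" for c
    using L2_imp_integrable[OF f(1)] L2_imp_integrable[OF g(1)] f(2) g(2) by simp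
  then have lim: "((\<lambda>n. L2_inner M (\<lambda>x. ?h c (T n x)) (?h c)) \<longlongrightarrow> 0) (infinity_in \<Gamma>)" for c
    using mix h[of c] by (auto simp: strong_mixing_def koopman_def)
  have "((\<lambda>n. \<Sum>c\<in>{1, -1, \<i>, -\<i>}. c * L2_inner M (\<lambda>x. ?h c (T n x)) (?h c)) \<longlongrightarrow>
      (\<Sum>c\<in>{1, -1, \<i>, -\<i>}. c * 0)) (infinity_in \<Gamma>)"
    by (intro tendsto_sum tendsto_mult tendsto_const lim)
  then have "((\<lambda>n. (\<Sum>c\<in>{1, -1, \<i>, -\<i>}. c * L2_inner M (\<lambda>x. ?h c (T n x)) (?h c)) / 4) \<longlongrightarrow> 0 / 4)
      (infinity_in \<Gamma>)"
    by (intro tendsto_divide tendsto_const) auto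
  moreover have "\<forall>\<^sub>F n in infinity_in \<Gamma>. (\<Sum>c\<in>{1, -1, \<i>, -\<i>}. c * L2_inner M (\<lambda>x. ?h c (T n x)) (?h c)) / 4
      = L2_inner M (\<lambda>x. f (T n x)) g"
    using eventually_infinity_in
  proof eventually_elim
    case (elim n)
    show ?case unfolding L2_inner_polarization[OF mp[OF elim] f(1) g(1), symmetric] by simp
  qed
  ultimately show ?thesis
    using tendsto_cong by fastforce
qed

section \<open>Going to infinity\<close>

lemma infinity_in_mono: "A \<subseteq> B \<Longrightarrow> infinity_in A \<le> infinity_in B"
  unfolding infinity_in_def by (intro inf_mono order_refl) simp

lemma infinity_in_UNIV: "infinity_in UNIV = at_infinity"
  by (simp add: infinity_in_def)

lemma tendsto_at_infinityI_sequentially: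
  fixes h :: "'a::real_normed_vector \<Rightarrow> 'b::topological_space"
  assumes "\<And>t. filterlim t at_infinity sequentially \<Longrightarrow> (\<lambda>k. h (t k)) \<longlonglongrightarrow> l"
  shows "(h \<longlongrightarrow> l) at_infinity"
proof (rule topological_tendstoI, rule ccontr)
  fix U assume U: "open U" "l \<in> U" and "\<not> (\<forall>\<^sub>F x in at_infinity. h x \<in> U)"
  then have "\<forall>k. \<exists>x. norm x \<ge> real k \<and> h x \<notin> U"
    by (auto simp: eventually_at_infinity)
  from choice[OF this] obtain t where t: "\<And>k. norm (t k) \<ge> real k" "\<And>k. h (t k) \<notin> U" by blast
  have "filterlim t at_infinity sequentially"
    by (rule filterlim_norm_at_top_imp_at_infinity,
        rule filterlim_at_top_mono[OF filterlim_real_sequentially]) (use t in auto)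
  from topological_tendstoD[OF assms[OF this] U] t(2) show False
    by (auto simp: eventually_sequentially)
qed

section \<open>Integer and fractional parts of vectors\<close>

lemma vfloor_add_vfrac: "vfloor v + vfrac v = v"
  by (simp add: vec_eq_iff vfloor_def vfrac_def frac_def)

lemma vfloor_in_lattice [simp]: "vfloor v \<in> integer_lattice"
  by (simp add: vfloor_def integer_lattice_def)

lemma vfrac_in_cube [simp]: "vfrac v \<in> unit_cube"
  by (simp add: vfrac_def unit_cube_def frac_lt_1)

lemma lattice_plus_cube:
  assumes "n \<in> integer_lattice" "r \<in> unit_cube"
  shows "vfloor (n + r) = n" "vfrac (n + r) = r"
proof -
  show "vfloor (n + r) = n" unfolding vec_eq_iff
  proof
    fix i
    have "n $ i \<in> \<int>" using assms(1) by (simp add: integer_lattice_def)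
    then obtain m :: int where m: "n $ i = of_int m" by (auto elim: Ints_cases)
    show "vfloor (n + r) $ i = n $ i"
      using assms(2) unfolding vfloor_def unit_cube_def
      by (simp add: m floor_eq_iff)
  qed
  then show "vfrac (n + r) = r" using vfloor_add_vfrac[of "n + r"] by simp
qed

lemma uminus_in_lattice: "n \<in> integer_lattice \<Longrightarrow> - n \<in> integer_lattice"
  by (simp add: integer_lattice_def)

lemma countable_integer_lattice: "countable (integer_lattice :: (real ^ 'n) set)"
proof (rule countable_subset)
  show "integer_lattice \<subseteq> range (\<lambda>f :: 'n \<Rightarrow> int. \<chi> i. real_of_int (f i))"
  proof
    fix v :: "real ^ 'n" assume "v \<in> integer_lattice"
    then have "v = (\<chi> i. real_of_int \<lfloor>v $ i\<rfloor>)"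
      by (auto simp: integer_lattice_def vec_eq_iff)
    then show "v \<in> range (\<lambda>f :: 'n \<Rightarrow> int. \<chi> i. real_of_int (f i))"
      by (intro image_eqI[of _ _ "\<lambda>i. \<lfloor>v $ i\<rfloor>"]) auto
  qed
qed auto

lemma unit_cube_lebesgue: "(unit_cube :: (real ^ 'n) set) \<in> sets lebesgue"
  and emeasure_unit_cube: "emeasure lebesgue (unit_cube :: (real ^ 'n) set) = 1"
proof -
  have "unit_cube = (\<Inter>i. {r :: real ^ 'n. 0 \<le> r $ i \<and> r $ i < 1})"
    by (auto simp: unit_cube_def)
  also have "\<dots> \<in> sets borel" by measurable
  finally show *: "(unit_cube :: (real ^ 'n) set) \<in> sets lebesgue" by simp
  have box: "box 0 1 \<subseteq> (unit_cube :: (real ^ 'n) set)" "unit_cube \<subseteq> cbox 0 (1 :: real ^ 'n)"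
    by (auto simp: unit_cube_def mem_box_cart less_imp_le)
  have "(\<Prod>b\<in>Basis. (1 :: real ^ 'n) \<bullet> b) = 1"
    by (rule prod.neutral) (auto simp: Basis_vec_def inner_axis)
  moreover have "(0 :: real ^ 'n) \<bullet> b \<le> 1 \<bullet> b" if "b \<in> Basis" for b
    using that by (auto simp: Basis_vec_def inner_axis)
  ultimately have "emeasure lborel (box 0 (1 :: real ^ 'n)) = 1" "emeasure lborel (cbox 0 (1 :: real ^ 'n)) = 1"
    by (simp_all add: emeasure_lborel_box_eq emeasure_lborel_cbox_eq)
  then show "emeasure lebesgue (unit_cube :: (real ^ 'n) set) = 1"
    using emeasure_mono[OF box(1) *] emeasure_mono[OF box(2), of lebesgue] by (simp add: antisym)
qed

lemma space_cube [simp]: "space (lebesgue_on unit_cube) = unit_cube"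
  by simp

lemma sets_cube_iff: "A \<in> sets (lebesgue_on unit_cube) \<longleftrightarrow> A \<in> sets lebesgue \<and> A \<subseteq> unit_cube"
  using sets_restrict_space_iff[of unit_cube lebesgue] unit_cube_lebesgue by auto

lemma emeasure_cube: "A \<subseteq> unit_cube \<Longrightarrow> emeasure (lebesgue_on unit_cube) A = emeasure lebesgue A"
  by (rule emeasure_restrict_space) (simp_all add: unit_cube_lebesgue)

lemma prob_space_cube: "prob_space (lebesgue_on (unit_cube :: (real ^ 'n) set))"
  by (rule prob_spaceI) (simp add: emeasure_cube emeasure_unit_cube)

lemma emeasure_lebesgue_translation:
  "emeasure lebesgue ((+) a ` S) = emeasure lebesgue (S :: (real ^ 'n) set)"
  using emeasure_lebesgue_affine[of 1 a S] by (simp add: add.commute)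

section \<open>The suspension preserves the product measure\<close>

lemma vfrac_translation_vimage:
  assumes "A \<subseteq> unit_cube"
  shows "(\<lambda>r. vfrac (t + r)) -` A \<inter> unit_cube
    = (\<Union>n\<in>integer_lattice. unit_cube \<inter> (+) (n - t) ` A)"
proof (intro equalityI subsetI)
  fix r assume "r \<in> (\<lambda>r. vfrac (t + r)) -` A \<inter> unit_cube"
  moreover have "r = vfloor (t + r) - t + vfrac (t + r)"
    using vfloor_add_vfrac[of "t + r"] by (simp add: algebra_simps)
  ultimately show "r \<in> (\<Union>n\<in>integer_lattice. unit_cube \<inter> (+) (n - t) ` A)"
    by (intro UN_I[of "vfloor (t + r)"]) (auto intro: image_eqI[of _ _ "vfrac (t + r)"])
next
  fix r assume "r \<in> (\<Union>n\<in>integer_lattice. unit_cube \<inter> (+) (n - t) ` A)"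
  then obtain n a where "n \<in> integer_lattice" "a \<in> A" "r \<in> unit_cube" "r = n - t + a" by auto
  with lattice_plus_cube(2)[of n a] assms show "r \<in> (\<lambda>r. vfrac (t + r)) -` A \<inter> unit_cube"
    by auto
qed

lemma disjoint_lattice_translates:
  "disjoint_family_on (\<lambda>n :: real ^ 'n. (+) (n - t) ` unit_cube) integer_lattice"
proof -
  have "n = n'" if "n \<in> integer_lattice" "n' \<in> integer_lattice" "a \<in> unit_cube" "a' \<in> unit_cube"
    "n - t + a = n' - t + a'" for n n' a a' :: "real ^ 'n"
  proof -
    have "n + a = n' + a'" using that(5) by (simp add: algebra_simps)
    then show ?thesis using lattice_plus_cube(1)[OF that(1,3)] lattice_plus_cube(1)[OF that(2,4)] by simp
  qed
  then show ?thesis unfolding disjoint_family_on_def by blast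
qed

text \<open>
  Translation of the torus \<open>\<real>\<^sup>d / \<int>\<^sup>d\<close>, seen on the fundamental domain: it cuts the cube into
  countably many pieces and moves each of them by a vector; the images are again a partition.
\<close>
lemma vfrac_translation_measure_preserving:
  "measure_preserving_map (lebesgue_on unit_cube) (\<lambda>r :: real ^ 'n. vfrac (t + r))"
proof -
  let ?C = "lebesgue_on (unit_cube :: (real ^ 'n) set)" and ?\<phi> = "\<lambda>r. vfrac (t + r)"
  have vim: "?\<phi> -` A \<inter> space ?C \<in> sets ?C" if "A \<in> sets ?C" for A
    using that unfolding space_cube
    by (subst vfrac_translation_vimage)
       (auto simp: sets_cube_iff countable_integer_lattice unit_cube_lebesgue lebesgue_sets_translation
             intro!: sets.countable_UN' sets.Int)
  have meas: "?\<phi> \<in> ?C \<rightarrow>\<^sub>M ?C"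
    by (rule measurableI[OF _ vim]) simp_all
  moreover have "distr ?C ?C ?\<phi> = ?C"
  proof (rule measure_eqI)
    fix A assume "A \<in> sets (distr ?C ?C ?\<phi>)"
    then have A: "A \<in> sets ?C" "A \<in> sets lebesgue" "A \<subseteq> unit_cube" by (auto simp: sets_cube_iff)
    \<comment> \<open>Moving the \<open>n\<close>-th piece of the preimage back by \<open>t - n\<close> gives a piece of \<open>A\<close>, written as a
      translate of the cube for \<open>- t\<close> and \<open>- n\<close> so that the same disjointness statement applies.\<close>
    have piece: "(+) (t - n) ` (unit_cube \<inter> (+) (n - t) ` A) = A \<inter> (+) (- n - (- t)) ` unit_cube" for n
    proof (intro equalityI subsetI)
      fix x assume "x \<in> (+) (t - n) ` (unit_cube \<inter> (+) (n - t) ` A)"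
      then obtain r a where "x = t - n + r" "r = n - t + a" "r \<in> unit_cube" "a \<in> A" by blast
      then show "x \<in> A \<inter> (+) (- n - (- t)) ` unit_cube"
        by (auto intro: image_eqI[of _ _ r])
    next
      fix x assume "x \<in> A \<inter> (+) (- n - (- t)) ` unit_cube"
      then obtain r where "x = - n - (- t) + r" "r \<in> unit_cube" "x \<in> A" by blast
      moreover from this have "r \<in> (+) (n - t) ` A" by (intro image_eqI[of _ _ x]) auto
      ultimately show "x \<in> (+) (t - n) ` (unit_cube \<inter> (+) (n - t) ` A)"
        by (intro image_eqI[of _ _ r]) auto
    qed
    have "emeasure (distr ?C ?C ?\<phi>) A = emeasure lebesgue (?\<phi> -` A \<inter> unit_cube)"
      using A by (simp add: emeasure_distr[OF meas] emeasure_cube)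
    also have "\<dots> = (\<integral>\<^sup>+n. emeasure lebesgue (unit_cube \<inter> (+) (n - t) ` A) \<partial>count_space integer_lattice)"
      unfolding vfrac_translation_vimage[OF A(3)]
    proof (rule emeasure_UN_countable)
      show "disjoint_family_on (\<lambda>n. unit_cube \<inter> (+) (n - t) ` A) integer_lattice"
        using disjoint_lattice_translates[of t] A(3) unfolding disjoint_family_on_def by blast
    qed (use A in \<open>auto simp: countable_integer_lattice intro!: sets.Int unit_cube_lebesgue lebesgue_sets_translation\<close>)
    also have "\<dots> = (\<integral>\<^sup>+n. emeasure lebesgue (A \<inter> (+) (- n - (- t)) ` unit_cube) \<partial>count_space integer_lattice)"
      unfolding piece[symmetric] by (simp add: emeasure_lebesgue_translation)
    also have "\<dots> = (\<integral>\<^sup>+n. emeasure lebesgue (A \<inter> (+) (n - (- t)) ` unit_cube) \<partial>count_space integer_lattice)"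
    proof (rule nn_integral_bij_count_space[of uminus integer_lattice integer_lattice
          "\<lambda>n. emeasure lebesgue (A \<inter> (+) (n - (- t)) ` unit_cube)"])
      show "bij_betw uminus (integer_lattice :: (real ^ 'n) set) integer_lattice"
        by (rule bij_betwI[of _ _ _ uminus]) (auto simp: uminus_in_lattice)
    qed
    also have "\<dots> = emeasure lebesgue (\<Union>n\<in>integer_lattice. A \<inter> (+) (n - (- t)) ` unit_cube)"
    proof (rule emeasure_UN_countable[symmetric])
      show "disjoint_family_on (\<lambda>n. A \<inter> (+) (n - (- t)) ` unit_cube) integer_lattice"
        using disjoint_lattice_translates[of "- t"] unfolding disjoint_family_on_def by blast
    qed (use A in \<open>auto simp: countable_integer_lattice intro!: sets.Int unit_cube_lebesgue lebesgue_sets_translation\<close>)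
    also have "(\<Union>n\<in>integer_lattice. A \<inter> (+) (n - (- t)) ` unit_cube) = A"
    proof (intro equalityI subsetI)
      fix s assume "s \<in> A"
      moreover have "s = vfloor (s - t) - (- t) + vfrac (s - t)"
        using vfloor_add_vfrac[of "s - t"] by (simp add: algebra_simps)
      ultimately show "s \<in> (\<Union>n\<in>integer_lattice. A \<inter> (+) (n - (- t)) ` unit_cube)"
        by (intro UN_I[of "vfloor (s - t)"]) (auto intro: image_eqI[of _ _ "vfrac (s - t)"])
    qed auto
    finally show "emeasure (distr ?C ?C ?\<phi>) A = emeasure ?C A"
      using A by (simp add: emeasure_cube)
  qed simp
  ultimately show ?thesis by (simp add: measure_preserving_map_def)
qed

lemma vfloor_translation_measurable:
  "(\<lambda>r :: real ^ 'n. vfloor (t + r)) \<in> lebesgue_on unit_cube \<rightarrow>\<^sub>M count_space integer_lattice"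
proof -
  have "(\<lambda>r. vfloor (t + r)) -` {n} \<inter> unit_cube \<in> sets (lebesgue_on unit_cube)"
    if n: "n \<in> integer_lattice" for n :: "real ^ 'n"
  proof -
    have "(\<lambda>r. vfloor (t + r)) -` {n} \<inter> unit_cube = unit_cube \<inter> (+) (n - t) ` unit_cube"
    proof (intro equalityI subsetI)
      fix r assume r: "r \<in> (\<lambda>r. vfloor (t + r)) -` {n} \<inter> unit_cube"
      then have "r = n - t + vfrac (t + r)"
        using vfloor_add_vfrac[of "t + r"] by (simp add: algebra_simps)
      with r show "r \<in> unit_cube \<inter> (+) (n - t) ` unit_cube"
        by (auto intro: image_eqI[of _ _ "vfrac (t + r)"])
    next
      fix r assume "r \<in> unit_cube \<inter> (+) (n - t) ` unit_cube"
      with lattice_plus_cube(1)[OF n] show "r \<in> (\<lambda>r. vfloor (t + r)) -` {n} \<inter> unit_cube" by auto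
    qed
    then show ?thesis
      by (simp add: sets_cube_iff sets.Int unit_cube_lebesgue lebesgue_sets_translation)
  qed
  then show ?thesis
    by (subst measurable_count_space_eq_countable) (auto simp: countable_integer_lattice)
qed

text \<open>
  A skew product: on the fibre over \<open>r\<close> it acts by the single map \<open>T (vfloor (t + r))\<close>, which
  preserves \<open>M\<close>, and on the base by a translation of the torus.
\<close>
lemma suspension_measure_preserving:
  fixes T :: "real ^ 'n \<Rightarrow> 'a \<Rightarrow> 'a"
  assumes "prob_space M" and mp: "\<And>n. n \<in> integer_lattice \<Longrightarrow> measure_preserving_map M (T n)"
  shows "measure_preserving_map (M \<Otimes>\<^sub>M lebesgue_on unit_cube) (suspension T t)"
proof -
  let ?C = "lebesgue_on (unit_cube :: (real ^ 'n) set)"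
  let ?N = "M \<Otimes>\<^sub>M ?C" and ?\<phi> = "\<lambda>r. vfrac (t + r)" and ?n = "\<lambda>r. vfloor (t + r)"
  interpret M: prob_space M by fact
  interpret C: prob_space ?C by (rule prob_space_cube)
  interpret N: pair_prob_space M ?C ..
  have \<phi> [measurable]: "?\<phi> \<in> ?C \<rightarrow>\<^sub>M ?C" and \<phi>_mp: "distr ?C ?C ?\<phi> = ?C"
    using vfrac_translation_measure_preserving[of t] by (auto simp: measure_preserving_map_def)
  have T: "T n \<in> M \<rightarrow>\<^sub>M M" "distr M M (T n) = M" if "n \<in> integer_lattice" for n
    using mp[OF that] by (auto simp: measure_preserving_map_def)
  have "(\<lambda>\<omega>. T (?n (snd \<omega>)) (fst \<omega>)) \<in> ?N \<rightarrow>\<^sub>M M"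
  proof (rule measurable_compose_countable'[where f = "\<lambda>n \<omega>. T n (fst \<omega>)" and I = integer_lattice])
    show "(\<lambda>\<omega>. T n (fst \<omega>)) \<in> ?N \<rightarrow>\<^sub>M M" if "n \<in> integer_lattice" for n
      by (rule measurable_compose[OF measurable_fst T(1)[OF that]])
    show "(\<lambda>\<omega>. ?n (snd \<omega>)) \<in> ?N \<rightarrow>\<^sub>M count_space integer_lattice"
      by (rule measurable_compose[OF measurable_snd vfloor_translation_measurable])
  qed (rule countable_integer_lattice)
  then have S: "suspension T t \<in> ?N \<rightarrow>\<^sub>M ?N"
    unfolding suspension_def split_beta' by measurable
  have "distr ?N ?N (suspension T t) = ?N"
  proof (rule measure_eqI)
    fix A assume "A \<in> sets (distr ?N ?N (suspension T t))"
    then have A: "A \<in> sets ?N" by simp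
    let ?m = "\<lambda>s. emeasure M ((\<lambda>x. (x, s)) -` A)"
    have m [measurable]: "?m \<in> borel_measurable ?C"
      by (rule N.measurable_emeasure_Pair2[OF A])
    have "emeasure (distr ?N ?N (suspension T t)) A = emeasure ?N (suspension T t -` A \<inter> space ?N)"
      by (rule emeasure_distr[OF S A])
    also have "\<dots> = (\<integral>\<^sup>+r. emeasure M ((\<lambda>x. (x, r)) -` (suspension T t -` A \<inter> space ?N)) \<partial>?C)"
      by (rule N.emeasure_pair_measure_alt2[OF measurable_sets[OF S A]])
    also have "\<dots> = (\<integral>\<^sup>+r. ?m (?\<phi> r) \<partial>?C)"
    proof (rule nn_integral_cong)
      fix r assume "r \<in> space ?C"
      then have "(\<lambda>x. (x, r)) -` (suspension T t -` A \<inter> space ?N)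
          = T (?n r) -` ((\<lambda>x. (x, ?\<phi> r)) -` A) \<inter> space M"
        by (auto simp: suspension_def space_pair_measure)
      also have "emeasure M \<dots> = emeasure (distr M M (T (?n r))) ((\<lambda>x. (x, ?\<phi> r)) -` A)"
        by (rule emeasure_distr[symmetric]) (auto intro!: T sets_Pair2 A)
      finally show "emeasure M ((\<lambda>x. (x, r)) -` (suspension T t -` A \<inter> space ?N)) = ?m (?\<phi> r)"
        by (simp add: T)
    qed
    also have "\<dots> = (\<integral>\<^sup>+s. ?m s \<partial>distr ?C ?C ?\<phi>)"
      by (rule nn_integral_distr[symmetric]) measurable
    also have "\<dots> = emeasure ?N A"
      unfolding \<phi>_mp by (rule N.emeasure_pair_measure_alt2[OF A, symmetric])
    finally show "emeasure (distr ?N ?N (suspension T t)) A = emeasure ?N A" .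
  qed simp
  with S show ?thesis by (simp add: measure_preserving_map_def)
qed

section \<open>Correlations of the suspension\<close>

text \<open>
  \<open>t k\<close> and \<open>vfloor (t k + r)\<close> differ by a vector which is bounded independently of \<open>k\<close>.
\<close>
lemma vfloor_translate_tends_to_infinity:
  fixes t :: "nat \<Rightarrow> real ^ 'n"
  assumes "filterlim t at_infinity sequentially"
  shows "filterlim (\<lambda>k. vfloor (t k + r)) (infinity_in integer_lattice) sequentially"
proof -
  have bound: "norm (vfrac v) \<le> real CARD('n)" for v :: "real ^ 'n"
  proof -
    have "norm (vfrac v) \<le> (\<Sum>i\<in>UNIV. \<bar>vfrac v $ i\<bar>)" by (rule norm_le_l1_cart)
    also have "\<dots> \<le> (\<Sum>i\<in>(UNIV :: 'n set). 1)"
      by (intro sum_mono) (simp add: vfrac_def frac_lt_1 less_imp_le)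
    finally show ?thesis by simp
  qed
  have "norm (t k) - (norm r + real CARD('n)) \<le> norm (vfloor (t k + r))" for k
  proof -
    have "norm (t k) = norm (vfloor (t k + r) + vfrac (t k + r) - r)"
      by (simp only: vfloor_add_vfrac add_diff_cancel_right')
    also have "\<dots> \<le> norm (vfloor (t k + r)) + norm (vfrac (t k + r)) + norm r"
      using norm_triangle_ineq4[of "vfloor (t k + r) + vfrac (t k + r)" r]
        norm_triangle_ineq[of "vfloor (t k + r)" "vfrac (t k + r)"] by linarith
    finally show ?thesis using bound[of "t k + r"] by linarith
  qed
  then have le: "\<forall>\<^sub>F k in sequentially. norm (t k) - (norm r + real CARD('n)) \<le> norm (vfloor (t k + r))"
    by (intro always_eventually allI)
  have lim: "filterlim (\<lambda>k. norm (t k) - (norm r + real CARD('n))) at_top sequentially"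
    using filterlim_tendsto_add_at_top[OF tendsto_const[of "- (norm r + real CARD('n))"]
        filterlim_at_infinity_imp_norm_at_top[OF assms]] by (simp add: algebra_simps)
  have "filterlim (\<lambda>k. vfloor (t k + r)) at_infinity sequentially"
    by (rule filterlim_norm_at_top_imp_at_infinity[OF filterlim_at_top_mono[OF lim le]])
  then show ?thesis
    by (simp add: infinity_in_def filterlim_inf filterlim_principal)
qed

text \<open>
  The indicator may be centred without changing its inner products with \<open>g\<close>, as \<open>g\<close> has integral
  \<open>0\<close>.
\<close>
lemma (in prob_space) strong_mixing_indicator_correlations:
  assumes mix: "strong_mixing \<Gamma> M T"
    and mp: "\<And>g. g \<in> \<Gamma> \<Longrightarrow> measure_preserving_map M (T g)"
    and A [measurable]: "A \<in> sets M" and g: "g \<in> L2 M" "(LINT x|M. g x) = 0"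
  shows "((\<lambda>n. L2_inner M (\<lambda>x. indicator A (T n x)) g) \<longlongrightarrow> 0) (infinity_in \<Gamma>)"
proof -
  define a :: complex where "a = of_real (measure M A)"
  have ind: "(indicator A :: 'a \<Rightarrow> complex) \<in> L2 M"
    by (rule L2_bounded[of _ 1]) (auto simp: indicator_def)
  have const: "(\<lambda>_. - a) \<in> L2 M" by (rule L2_bounded[of _ "cmod a"]) auto
  have f: "(\<lambda>x. indicator A x + - a) \<in> L2 M" by (rule L2_add[OF ind const])
  have "(LINT x|M. indicator A x) = (LINT x|M. complex_of_real (indicator A x))"
    by (intro Bochner_Integration.integral_cong) (auto simp: indicator_def)
  then have int_ind: "(LINT x|M. indicator A x) = a" by (simp add: a_def)
  have "(LINT x|M. indicator A x + - a) = (LINT x|M. indicator A x) + (LINT x|M. - a)"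
    using L2_imp_integrable[OF ind] by (intro Bochner_Integration.integral_add) auto
  also have "\<dots> = 0" by (simp add: int_ind prob_space)
  finally have f0: "(LINT x|M. indicator A x + - a) = 0" .
  have "L2_inner M (\<lambda>_. - a) g = - a * cnj (LINT x|M. g x)"
    by (simp add: L2_inner_def)
  then have "L2_inner M (\<lambda>_. - a) g = 0" using g(2) by simp
  then have "L2_inner M (\<lambda>x. indicator A (T n x) + - a) g = L2_inner M (\<lambda>x. indicator A (T n x)) g"
    if "n \<in> \<Gamma>" for n
    using L2_inner_add_left[OF L2_compose[OF mp[OF that] ind] const g(1)] by simp
  then have "\<forall>\<^sub>F n in infinity_in \<Gamma>. L2_inner M (\<lambda>x. indicator A (T n x) + - a) g
      = L2_inner M (\<lambda>x. indicator A (T n x)) g"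
    by (intro eventually_mono[OF eventually_infinity_in]) blast
  then show ?thesis
    using tendsto_cong strong_mixing_correlations[OF mix mp f f0 g] by fast
qed

text \<open>
  For a rectangle the dependence of the integrand on the moving point \<open>vfrac (t + r)\<close> of the cube
  is confined to the bounded factor \<open>indicator B (vfrac (t + r))\<close>; the other factor is a
  correlation between the fixed functions \<open>indicator A\<close> and \<open>G (\<cdot>, r)\<close> of the mixing action.
\<close>
lemma suspension_rectangle_correlations_decay:
  fixes T :: "real ^ 'n \<Rightarrow> 'a \<Rightarrow> 'a"
  defines "C \<equiv> lebesgue_on (unit_cube :: (real ^ 'n) set)"
  assumes M: "prob_space M"
    and mix: "strong_mixing integer_lattice M T"
    and mp: "\<And>n. n \<in> integer_lattice \<Longrightarrow> measure_preserving_map M (T n)"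
    and G: "G \<in> L2 (M \<Otimes>\<^sub>M C)" and G0: "AE r in C. (LINT x|M. G (x, r)) = 0"
    and A [measurable]: "A \<in> sets M" and B [measurable]: "B \<in> sets C"
    and t: "filterlim t at_infinity sequentially"
  shows "(\<lambda>k. L2_inner (M \<Otimes>\<^sub>M C) (\<lambda>\<omega>. indicator (A \<times> B) (suspension T (t k) \<omega>)) G) \<longlonglongrightarrow> 0"
proof -
  let ?N = "M \<Otimes>\<^sub>M C"
  interpret M: prob_space M by fact
  interpret C: prob_space C unfolding C_def by (rule prob_space_cube)
  interpret N: pair_prob_space M C ..
  have S: "measure_preserving_map ?N (suspension T (t k))" for k
    unfolding C_def by (rule suspension_measure_preserving[OF M mp])
  have \<phi> [measurable]: "(\<lambda>r. vfrac (t k + r)) \<in> C \<rightarrow>\<^sub>M C" for k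
    unfolding C_def by (rule measure_preserving_map_measurable[OF vfrac_translation_measure_preserving])
  note G_meas [measurable] = L2_measurable[OF G]
  have ind: "(indicator (A \<times> B) :: _ \<Rightarrow> complex) \<in> L2 ?N"
    by (rule N.L2_bounded[of _ 1]) (auto simp: indicator_def)
  define c where "c k r = L2_inner M (\<lambda>x. indicator A (T (vfloor (t k + r)) x)) (\<lambda>x. G (x, r))" for k r
  let ?h = "\<lambda>k r. indicator B (vfrac (t k + r)) * c k r"
  have int: "integrable ?N (\<lambda>(x, r). indicator (A \<times> B) (suspension T (t k) (x, r)) * cnj (G (x, r)))" for k
    using L2_inner_integrable[OF L2_compose[OF S[of k] ind] G] by (simp add: split_beta')
  have section_eq: "(LINT x|M. indicator (A \<times> B) (suspension T (t k) (x, r)) * cnj (G (x, r))) = ?h k r" for k r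
  proof -
    have "(LINT x|M. indicator (A \<times> B) (suspension T (t k) (x, r)) * cnj (G (x, r)))
        = (LINT x|M. indicator B (vfrac (t k + r)) * (indicator A (T (vfloor (t k + r)) x) * cnj (G (x, r))))"
      by (intro Bochner_Integration.integral_cong) (auto simp: suspension_def indicator_def)
    then show ?thesis by (simp add: c_def L2_inner_def)
  qed
  have fubini: "L2_inner ?N (\<lambda>\<omega>. indicator (A \<times> B) (suspension T (t k) \<omega>)) G = (LINT r|C. ?h k r)" for k
    using N.integral_snd[OF int[of k]] by (simp add: L2_inner_def section_eq split_beta')
  have G_int: "integrable ?N (\<lambda>(x, r). cmod (G (x, r)))"
    using N.L2_imp_integrable[OF G] by (simp add: split_beta')
  have G2_int: "integrable ?N (\<lambda>(x, r). (cmod (G (x, r)))\<^sup>2)"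
    using L2_integrable[OF G] by (simp add: split_beta')
  have "(\<lambda>k. LINT r|C. ?h k r) \<longlonglongrightarrow> (LINT r|C. 0)"
  proof (rule integral_dominated_convergence[where w = "\<lambda>r. LINT x|M. cmod (G (x, r))"])
    show "?h k \<in> borel_measurable C" for k
      using N.integrable_snd[OF int[of k]] by (simp add: section_eq)
    show "integrable C (\<lambda>r. LINT x|M. cmod (G (x, r)))"
      by (rule N.integrable_snd[OF G_int])
    show "AE r in C. norm (?h k r) \<le> (LINT x|M. cmod (G (x, r)))" for k
      using N.AE_integrable_snd[OF G_int] N.AE_integrable_snd[OF int[of k]]
    proof eventually_elim
      case (elim r)
      have "norm (?h k r) \<le> (LINT x|M. norm (indicator (A \<times> B) (suspension T (t k) (x, r)) * cnj (G (x, r))))"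
        unfolding section_eq[symmetric] by (rule integral_norm_bound)
      also have "\<dots> \<le> (LINT x|M. cmod (G (x, r)))"
        by (rule integral_mono[OF integrable_norm[OF elim(2)] elim(1)]) (auto simp: indicator_def norm_mult)
      finally show ?case .
    qed
    show "AE r in C. (\<lambda>k. ?h k r) \<longlonglongrightarrow> 0"
      using G0 N.AE_integrable_snd[OF G2_int] AE_space
    proof eventually_elim
      case (elim r)
      have "(\<lambda>x. G (x, r)) \<in> L2 M"
        using elim measurable_Pair1[OF G_meas elim(3)] by (simp add: L2_def)
      from filterlim_compose[OF M.strong_mixing_indicator_correlations[OF mix mp A this elim(1)]
          vfloor_translate_tends_to_infinity[OF t, of r]]
      have c: "(\<lambda>k. c k r) \<longlonglongrightarrow> 0" by (simp add: c_def)
      show ?case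
      proof (rule Lim_null_comparison[OF _ tendsto_norm_zero[OF c]])
        show "\<forall>\<^sub>F k in sequentially. norm (?h k r) \<le> norm (c k r)"
          by (intro always_eventually allI) (auto simp: indicator_def)
      qed
    qed
  qed simp
  then show ?thesis by (simp add: fubini)
qed

section \<open>Passing to the completed product\<close>

lemma completion_ex_borel_measurable_complex:
  fixes f :: "'a \<Rightarrow> complex"
  assumes f: "f \<in> borel_measurable (completion M)"
  shows "\<exists>g\<in>borel_measurable M. AE x in M. f x = g x"
proof -
  note [measurable] = f
  have "(\<lambda>x. Re (f x)) \<in> borel_measurable (completion M)" "(\<lambda>x. Im (f x)) \<in> borel_measurable (completion M)"
    by measurable
  from this[THEN completion_ex_borel_measurable_real] obtain u v
    where u [measurable]: "u \<in> borel_measurable M" and v [measurable]: "v \<in> borel_measurable M"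
      and ae: "AE x in M. Re (f x) = u x" "AE x in M. Im (f x) = v x" by blast
  show ?thesis
  proof (rule bexI)
    show "(\<lambda>x. Complex (u x) (v x)) \<in> borel_measurable M"
      unfolding Complex_eq by measurable
    show "AE x in M. f x = Complex (u x) (v x)"
      using ae by eventually_elim (simp add: complex_eq_iff)
  qed
qed

lemma measure_preserving_map_completion:
  assumes "measure_preserving_map M S"
  shows "S \<in> completion M \<rightarrow>\<^sub>M completion M"
proof -
  have S: "S \<in> M \<rightarrow>\<^sub>M M" "distr M M S = M"
    using assms by (auto simp: measure_preserving_map_def)
  have "S \<in> completion M \<rightarrow>\<^sub>M M" by (rule measurable_completion[OF S(1)])
  then show ?thesis
    by (rule completion.measurable_completion2) (simp add: distr_completion S)
qed

text \<open>
  The mean \<open>m r\<close> of the section of \<open>f\<close> at \<open>r\<close> is seen to vanish by testing \<open>f\<close> against the cube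
  function \<open>m / \<bar>m\<bar>\<close> (with value \<open>0\<close> where \<open>m = 0\<close>), for which the inner product is \<open>\<integral> \<bar>m\<bar>\<close>.
  This test function is bounded, so its square integrability is evident, unlike that of \<open>m\<close>.
  Passing to \<open>G\<close> is needed since the sections of a function measurable for the completion need
  not all be measurable.
\<close>
lemma L2_O_version:
  fixes M :: "'a measure"
  defines "C \<equiv> lebesgue_on (unit_cube :: (real ^ 'n) set)"
  assumes M: "prob_space M" and f: "f \<in> L2_O M"
  shows "\<exists>G\<in>L2 (M \<Otimes>\<^sub>M C). (AE \<omega> in M \<Otimes>\<^sub>M C. f \<omega> = G \<omega>) \<and> (AE r in C. (LINT x|M. G (x, r)) = 0)"
proof -
  let ?N = "M \<Otimes>\<^sub>M C"
  interpret M: prob_space M by fact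
  interpret C: prob_space C unfolding C_def by (rule prob_space_cube)
  interpret N: pair_prob_space M C ..
  have P: "suspension_space M = completion ?N" by (simp add: suspension_space_def C_def)
  from f have f_L2: "f \<in> L2 (completion ?N)"
    and orth: "\<And>h. h \<in> cube_functions \<Longrightarrow> L2_inner (completion ?N) f h = 0"
    by (auto simp: L2_O_def L2_orthogonal_complement_def P)
  note f_meas [measurable] = L2_measurable[OF f_L2]
  from completion_ex_borel_measurable_complex[OF f_meas] obtain G
    where G_meas [measurable]: "G \<in> borel_measurable ?N" and fG: "AE \<omega> in ?N. f \<omega> = G \<omega>" by blast
  note G_meas' [measurable] = measurable_completion[OF G_meas]
  have "integrable (completion ?N) (\<lambda>\<omega>. (cmod (f \<omega>))\<^sup>2) \<longleftrightarrow> integrable (completion ?N) (\<lambda>\<omega>. (cmod (G \<omega>))\<^sup>2)"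
    by (rule integrable_cong_AE) (use AE_completion[OF fG] in \<open>auto elim!: eventually_mono\<close>)
  then have G: "G \<in> L2 ?N"
    using L2_integrable[OF f_L2] by (simp add: L2_def integrable_completion)
  define m where "m r = (LINT x|M. G (x, r))" for r
  define s where "s r = m r / complex_of_real (cmod (m r))" for r
  have m_int: "integrable C m"
    unfolding m_def using N.integrable_snd[of "\<lambda>x r. G (x, r)"] N.L2_imp_integrable[OF G] by simp
  note m_meas [measurable] = borel_measurable_integrable[OF m_int]
  have s_meas [measurable]: "s \<in> borel_measurable C"
    unfolding s_def by measurable
  have s_le: "cmod (s r) \<le> 1" for r by (simp add: s_def norm_divide)
  have s_L2: "s \<in> L2 C" by (rule C.L2_bounded[OF s_meas s_le])
  have sn_L2: "(\<lambda>\<omega>. s (snd \<omega>)) \<in> L2 ?N" by (rule N.L2_bounded[OF _ s_le]) measurable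
  have int: "integrable ?N (\<lambda>(x, r). G (x, r) * cnj (s r))"
    using L2_inner_integrable[OF G sn_L2] by (simp add: split_beta')
  have "(\<lambda>(x, r). s r) \<in> cube_functions"
    using s_L2 unfolding cube_functions_def C_def by blast
  from orth[OF this] have "0 = L2_inner (completion ?N) f (\<lambda>\<omega>. s (snd \<omega>))"
    by (simp add: split_beta')
  also have "\<dots> = L2_inner (completion ?N) G (\<lambda>\<omega>. s (snd \<omega>))"
    unfolding L2_inner_def
  proof (rule integral_cong_AE)
    have [measurable]: "(\<lambda>\<omega>. s (snd \<omega>)) \<in> borel_measurable (completion ?N)"
      by (rule measurable_completion) measurable
    show "(\<lambda>\<omega>. f \<omega> * cnj (s (snd \<omega>))) \<in> borel_measurable (completion ?N)"
      "(\<lambda>\<omega>. G \<omega> * cnj (s (snd \<omega>))) \<in> borel_measurable (completion ?N)" by measurable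
  qed (use AE_completion[OF fG] in \<open>auto elim!: eventually_mono\<close>)
  also have "\<dots> = L2_inner ?N G (\<lambda>\<omega>. s (snd \<omega>))"
    unfolding L2_inner_def by (rule integral_completion) measurable
  also have "\<dots> = (LINT r|C. LINT x|M. G (x, r) * cnj (s r))"
    using N.integral_snd[OF int] by (simp add: L2_inner_def split_beta')
  also have "\<dots> = (LINT r|C. complex_of_real (cmod (m r)))"
  proof (intro Bochner_Integration.integral_cong refl)
    fix r
    have "(LINT x|M. G (x, r) * cnj (s r)) = m r * cnj (s r)" by (simp add: m_def)
    also have "\<dots> = complex_of_real (cmod (m r))"
      by (simp add: s_def complex_norm_square[symmetric] power2_eq_square)
    finally show "(LINT x|M. G (x, r) * cnj (s r)) = complex_of_real (cmod (m r))" .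
  qed
  finally have "(LINT r|C. cmod (m r)) = 0" by simp
  then have "AE r in C. cmod (m r) = 0"
    using m_int by (subst (asm) integral_nonneg_eq_0_iff_AE) auto
  with G fG show ?thesis unfolding m_def by auto
qed

text \<open>
  A version \<open>G\<close> of \<open>f\<close> has the same correlations as \<open>f\<close>, since preimages of null sets under the
  suspension are null sets, and to \<open>G\<close> the rectangle argument applies on the uncompleted product.
\<close>
lemma strong_mixing_suspension_correlations:
  fixes T :: "real ^ 'n \<Rightarrow> 'a \<Rightarrow> 'a"
  assumes M: "prob_space M"
    and mix: "strong_mixing integer_lattice M T"
    and mp: "\<And>n. n \<in> integer_lattice \<Longrightarrow> measure_preserving_map M (T n)"
    and f: "f \<in> L2_O M"
  shows "((\<lambda>t. L2_inner (suspension_space M) (koopman (suspension T) t f) f) \<longlongrightarrow> 0) at_infinity"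
proof (rule tendsto_at_infinityI_sequentially)
  fix t :: "nat \<Rightarrow> real ^ 'n" assume t: "filterlim t at_infinity sequentially"
  let ?C = "lebesgue_on (unit_cube :: (real ^ 'n) set)"
  let ?N = "M \<Otimes>\<^sub>M ?C" and ?S = "\<lambda>k. suspension T (t k)"
  interpret M: prob_space M by fact
  interpret C: prob_space ?C by (rule prob_space_cube)
  interpret N: pair_prob_space M ?C ..
  from L2_O_version[OF M f] obtain G where G: "G \<in> L2 ?N"
    and fG: "AE \<omega> in ?N. f \<omega> = G \<omega>" and G0: "AE r in ?C. (LINT x|M. G (x, r)) = 0" by blast
  note [measurable] = L2_measurable[OF G]
  have S: "measure_preserving_map ?N (?S k)" for k
    by (rule suspension_measure_preserving[OF M mp])
  have "(LINT \<omega>|?N. G \<omega>) = (LINT r|?C. LINT x|M. G (x, r))"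
    using N.integral_snd[of "\<lambda>x r. G (x, r)"] N.L2_imp_integrable[OF G] by simp
  also have "\<dots> = (LINT r|?C. 0)"
    by (rule integral_cong_AE) (use G0 in measurable)
  finally have "(LINT \<omega>|?N. G \<omega>) = 0" by simp
  then have "(\<lambda>k. L2_inner ?N (\<lambda>\<omega>. G (?S k \<omega>)) G) \<longlonglongrightarrow> 0"
  proof (rule N.correlations_decay_from_generator[OF S G _ _ Int_stable_pair_measure_generator[of M ?C] _ _ G])
    show "{a \<times> b |a b. a \<in> sets M \<and> b \<in> sets ?C} \<subseteq> Pow (space ?N)"
      using pair_measure_closed[of M ?C] by (simp only: space_pair_measure)
    show "sets ?N = sigma_sets (space ?N) {a \<times> b |a b. a \<in> sets M \<and> b \<in> sets ?C}"
      by (simp only: sets_pair_measure space_pair_measure)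
    fix E assume "E \<in> {a \<times> b |a b. a \<in> sets M \<and> b \<in> sets ?C}"
    then obtain A B where "E = A \<times> B" "A \<in> sets M" "B \<in> sets ?C" by blast
    with suspension_rectangle_correlations_decay[OF M mix mp G G0 _ _ t]
    show "(\<lambda>k. L2_inner ?N (\<lambda>\<omega>. indicator E (?S k \<omega>)) G) \<longlonglongrightarrow> 0" by blast
  qed
  moreover have "L2_inner (suspension_space M) (koopman (suspension T) (t k) f) f
      = L2_inner ?N (\<lambda>\<omega>. G (?S k \<omega>)) G" for k
  proof -
    have S_meas [measurable]: "?S k \<in> ?N \<rightarrow>\<^sub>M ?N"
      by (rule measure_preserving_map_measurable[OF S])
    have S_compl [measurable]: "?S k \<in> completion ?N \<rightarrow>\<^sub>M completion ?N"
      by (rule measure_preserving_map_completion[OF S])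
    have f_meas [measurable]: "f \<in> borel_measurable (completion ?N)"
      using f by (auto simp: L2_O_def L2_orthogonal_complement_def suspension_space_def dest: L2_measurable)
    have fS: "(\<lambda>\<omega>. f (?S k \<omega>)) \<in> borel_measurable (completion ?N)"
      by (rule measurable_compose[OF S_compl f_meas])
    have "distr ?N ?N (?S k) = ?N" using S[of k] by (simp add: measure_preserving_map_def)
    then have "AE \<omega> in ?N. f (?S k \<omega>) = G (?S k \<omega>)"
      by (intro AE_distrD[OF S_meas]) (simp only: fG)
    with fG have "AE \<omega> in ?N. f (?S k \<omega>) * cnj (f \<omega>) = G (?S k \<omega>) * cnj (G \<omega>)"
      by eventually_elim simp
    then have ae: "AE \<omega> in completion ?N. f (?S k \<omega>) * cnj (f \<omega>) = G (?S k \<omega>) * cnj (G \<omega>)"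
      by (rule AE_completion)
    have GG: "(\<lambda>\<omega>. G (?S k \<omega>) * cnj (G \<omega>)) \<in> borel_measurable ?N" by measurable
    have "(LINT \<omega>|completion ?N. f (?S k \<omega>) * cnj (f \<omega>)) = (LINT \<omega>|completion ?N. G (?S k \<omega>) * cnj (G \<omega>))"
    proof (rule integral_cong_AE[OF _ _ ae])
      note [measurable] = fS
      show "(\<lambda>\<omega>. f (?S k \<omega>) * cnj (f \<omega>)) \<in> borel_measurable (completion ?N)" by measurable
      show "(\<lambda>\<omega>. G (?S k \<omega>) * cnj (G \<omega>)) \<in> borel_measurable (completion ?N)"
        by (rule measurable_completion[OF GG])
    qed
    also have "\<dots> = (LINT \<omega>|?N. G (?S k \<omega>) * cnj (G \<omega>))"
      by (rule integral_completion[OF GG])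
    finally show ?thesis by (simp add: L2_inner_def koopman_def suspension_space_def)
  qed
  ultimately show "(\<lambda>k. L2_inner (suspension_space M) (koopman (suspension T) (t k) f) f) \<longlonglongrightarrow> 0"
    by simp
qed

theorem proposition6p6:
  fixes M :: "'a measure"
    and T :: "real ^ 'n \<Rightarrow> 'a \<Rightarrow> 'a"
  assumes "lebesgue_probability_space M"
  shows "(free_Rd_action M T \<and> strong_mixing UNIV M T \<longrightarrow>
            (\<forall>e L. 1 \<le> e \<and> e \<le> CARD('n) \<and> L \<in> grassmannian e \<longrightarrow>
               strong_mixing_in_direction_Rd M T L)) \<and>
         (free_Zd_action M T \<and> strong_mixing integer_lattice M T \<longrightarrow>
            (\<forall>e L. 1 \<le> e \<and> e \<le> CARD('n) \<and> L \<in> grassmannian e \<longrightarrow>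
               strong_mixing_in_direction_Zd M T L))"
proof (intro conjI impI allI)
  fix e L
  assume "free_Rd_action M T \<and> strong_mixing UNIV M T"
  then show "strong_mixing_in_direction_Rd M T L"
    unfolding strong_mixing_in_direction_Rd_def strong_mixing_def
    using tendsto_mono[OF infinity_in_mono[OF subset_UNIV]] by blast
next
  fix e L
  assume Z: "free_Zd_action M T \<and> strong_mixing integer_lattice M T"
  then have mp: "measure_preserving_map M (T n)" if "n \<in> integer_lattice" for n
    using that by (simp add: free_mp_action_def measure_preserving_map_def)
  have M: "prob_space M" using assms by (simp add: lebesgue_probability_space_def)
  show "strong_mixing_in_direction_Zd M T L"
    unfolding strong_mixing_in_direction_Zd_def
  proof
    fix f :: "'a \<times> (real ^ 'n) \<Rightarrow> complex" assume "f \<in> L2_O M"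
    from strong_mixing_suspension_correlations[OF M conjunct2[OF Z] mp this]
    show "((\<lambda>t. L2_inner (suspension_space M) (koopman (suspension T) t f) f) \<longlongrightarrow> 0) (infinity_in L)"
      using tendsto_mono[OF infinity_in_mono[OF subset_UNIV[of L]]] by (simp add: infinity_in_UNIV)
  qed
qed

end
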